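(* Let $d\ge1$ be an integer and consider the non-degenerate simplex $S_d\subset\mathbb{R}^d$ with vertices $\mathbf{V}_i$, $1\le i\le d+1$, centred at $\mathbf{0}$, i.e., with $\sum_{j=1}^{d+1}\mathbf{V}_j=\mathbf{0}$. If $w$ is an allowable weight function, then the map between simplices $$T_d\to S_d:\quad (\theta_j)\mapsto \mathbf{x}=\sum_{j=1}^{d+1}w(\theta_j)\mathbf{V}_j$$ is one-to-one with image $$S_d^w:=\Bigl\{\mathbf{x}=\sum_{j=1}^{d+1}\lambda_j\mathbf{V}_j\ :\ \boldsymbol{\lambda}\in T_d,\ \sum_{j=1}^{d+1}w^{-1}(\lambda_j-\lambda_{\min})\le 1\Bigr\}\subset S_d,\qquad \lambda_{\min}=\min_{1\le j\le d+1}\lambda_j .$$ Moreover, if $w$ is complementary and $d=2$, then $S_2^w=S_2$, i.e., each point $\mathbf{x}$ in the triangle $S_2$ has unique baryweights $(w(\theta_j))$.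
   Context: $T_d:=\{\boldsymbol{\theta}\in\mathbb{R}^{d+1}:\theta_j\ge 0,\ \sum_{j=1}^{d+1}\theta_j=1\}$ is the standard unit simplex. The simplex $S_d$ is the convex hull of its vertices, so $S_d=\{\sum_{j=1}^{d+1}\lambda_j\mathbf{V}_j:\boldsymbol\lambda\in T_d\}$; non-degenerate means that the vertices are affinely independent. A function $w:[0,1]\to[0,1]$ is an allowable weight function (for the dimension $d$) if: (i) $w$ is increasing on $[0,1]$; (ii) $w(0)=0$ and $w(1)=1$; (iii) $\sum_{i=1}^{d+1}w(\theta_i)\le 1$ for all $\theta_i\ge 0$, $1\le i\le d+1$, such that $\sum_{i=1}^{d+1}\theta_i=1$. The inverse function of $w$ is denoted $w^{-1}$. The function $w$ is complementary if $w(x)+w(1-x)=1$ for all $0\le x\le 1$. When $\mathbf{x}=\sum_{j=1}^{d+1}w(\theta_j)\mathbf{V}_j$ with $\boldsymbol\theta\in T_d$, the numbers $w(\theta_j)$ are called baryweights of $\mathbf{x}$.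
   Formalization: The weight function w is taken strictly increasing, and for the image formula and the d=2 claim also a bijection of [0,1] (equivalently, continuous), so that its inverse is defined on all of [0,1]; conditions (i)-(iii) alone do not ensure this. *)

theory Defs
  imports "HOL-Analysis.Analysis" "HOL-Homology.Simplices"
begin

text \<open>The unit simplex \<open>T\<^sub>d\<close> is the library's \<^term>\<open>standard_simplex d\<close>: its coordinates are
  indexed by \<open>0, \<dots>, d\<close> (rather than \<open>1, \<dots>, d + 1\<close>) and vanish beyond \<open>d\<close>, so that its elements
  correspond exactly to vectors with \<open>d + 1\<close> entries.\<close>

text \<open>``Increasing'' is strict: a weight function is meant to have an inverse, and for a \<open>w\<close> that
  is constant on some interval the baryweight map need not be injective.\<close>

definition allowable_weight :: "nat \<Rightarrow> (real \<Rightarrow> real) \<Rightarrow> bool" where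
  "allowable_weight d w \<longleftrightarrow>
     w \<in> {0..1} \<rightarrow> {0..1} \<and>
     strict_mono_on {0..1} w \<and>
     w 0 = 0 \<and> w 1 = 1 \<and>
     (\<forall>\<theta>\<in>standard_simplex d. (\<Sum>i\<le>d. w (\<theta> i)) \<le> 1)"

definition complementary :: "(real \<Rightarrow> real) \<Rightarrow> bool" where
  "complementary w \<longleftrightarrow> (\<forall>x\<in>{0..1}. w x + w (1 - x) = 1)"

definition baryweight_map ::
    "nat \<Rightarrow> (nat \<Rightarrow> 'a::real_vector) \<Rightarrow> (real \<Rightarrow> real) \<Rightarrow> (nat \<Rightarrow> real) \<Rightarrow> 'a" where
  "baryweight_map d V w \<theta> = (\<Sum>j\<le>d. w (\<theta> j) *\<^sub>R V j)"

text \<open>The set \<open>S\<^sub>d\<^sup>w\<close>. The arguments of the inverse lie in \<open>[0, 1]\<close>, so \<^term>\<open>inv_into {0..1} w\<close> is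
  the inverse function of \<open>w\<close> whenever \<open>w\<close> is a bijection of \<open>[0, 1]\<close>.\<close>

definition baryweight_region ::
    "nat \<Rightarrow> (nat \<Rightarrow> 'a::real_vector) \<Rightarrow> (real \<Rightarrow> real) \<Rightarrow> 'a set" where
  "baryweight_region d V w =
     {(\<Sum>j\<le>d. l j *\<^sub>R V j) | l.
        l \<in> standard_simplex d \<and>
        (\<Sum>j\<le>d. inv_into {0..1} w (l j - Min (l ` {..d}))) \<le> 1}"

text \<open>Entries beyond \<open>d\<close> of a baryweight vector are \<open>w 0\<close>, which is \<open>0\<close> for an allowable \<open>w\<close>.\<close>

definition is_baryweights ::
    "nat \<Rightarrow> (nat \<Rightarrow> 'a::real_vector) \<Rightarrow> (real \<Rightarrow> real) \<Rightarrow> 'a \<Rightarrow> (nat \<Rightarrow> real) \<Rightarrow> bool" where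
  "is_baryweights d V w x b \<longleftrightarrow>
     (\<exists>\<theta>\<in>standard_simplex d. b = (\<lambda>j. w (\<theta> j)) \<and> x = (\<Sum>j\<le>d. b j *\<^sub>R V j))"

end

theory Submission
  imports Defs
begin

text \<open>
  Since the vertices sum to \<open>0\<close> and are affinely independent, the only linear relations between them
  are the multiples of \<open>\<Sum>j. V j = 0\<close>. Two coefficient vectors therefore represent the same point
  exactly when they differ by a constant shift, and the whole theorem is about shifting.

  \<^item> Injectivity. If \<open>\<theta>\<close> and \<open>\<phi>\<close> have the same image, then \<open>w (\<theta> j) - w (\<phi> j)\<close> is the
    same number for all \<open>j\<close>. Were it nonzero, strict monotonicity would make one of \<open>\<theta>\<close>, \<open>\<phi>\<close>
    larger than the other in every entry, although both sum to \<open>1\<close>.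

  \<^item> The image lies in the simplex. The weights \<open>w (\<theta> j)\<close> sum to at most \<open>1\<close>, and sharing the
    defect equally among them is a shift that produces barycentric coordinates.

  \<^item> Identification of the image. Shifting the coordinates \<open>l\<close> so that their minimum is \<open>0\<close>
    gives the smallest nonnegative coefficients of the point, so baryweights \<open>w (\<theta> j)\<close> of the same
    point dominate them, and applying the inverse \<open>v\<close> of \<open>w\<close> yields the inequality defining
    the region. Conversely, shift the minimal coefficients up by \<open>t\<close> until the largest one is \<open>1\<close>:
    the sum of their values under \<open>v\<close> starts at most at \<open>1\<close>, ends at least at \<open>1\<close>, and varies
    continuously, because a monotone function onto an interval is continuous. Where it equals \<open>1\<close>
    its summands form the required \<open>\<theta>\<close>.

  \<^item> The triangle. When \<open>d = 2\<close>, one minimal coefficient is \<open>0\<close> and the other two, \<open>a\<close> and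
    \<open>b\<close>, satisfy \<open>a + b \<le> 1\<close>. If \<open>w\<close> is complementary, so is \<open>v\<close>, whence
    \<open>v a + v b \<le> v a + v (1 - a) = 1\<close>, and the region is the whole triangle.
\<close>

section \<open>Coefficients with respect to the vertices of a centred simplex\<close>

lemma standard_simplexI:
  assumes "\<And>j. j \<le> d \<Longrightarrow> 0 \<le> x j" and "\<And>j. j > d \<Longrightarrow> x j = 0" and "(\<Sum>j\<le>d. x j) = 1"
  shows "x \<in> standard_simplex d"
proof -
  have nonneg: "0 \<le> x j" for j
    using assms(1,2)[of j] by (cases "j \<le> d") auto
  have "x j \<le> 1" for j
  proof (cases "j \<le> d")
    case True
    then show ?thesis
      using member_le_sum[of j "{..d}" x] nonneg assms(3) by simp
  qed (simp add: assms(2))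
  with nonneg assms show ?thesis
    by (simp add: standard_simplex_def)
qed

lemma standard_simplexD:
  assumes "x \<in> standard_simplex d"
  shows "0 \<le> x j" "x j \<le> 1" "j > d \<Longrightarrow> x j = 0" "(\<Sum>j\<le>d. x j) = 1"
  using assms by (auto simp: standard_simplex_def)

lemma simplex_combination_in_hull:
  fixes V :: "nat \<Rightarrow> 'a::real_vector"
  assumes "l \<in> standard_simplex d"
  shows "(\<Sum>j\<le>d. l j *\<^sub>R V j) \<in> convex hull (V ` {..d})"
  using standard_simplexD[OF assms] by (intro convex_sum) (auto intro: hull_inc)

lemma hull_point_is_simplex_combination:
  fixes V :: "nat \<Rightarrow> 'a::real_vector"
  assumes "inj_on V {..d}" and "x \<in> convex hull (V ` {..d})"
  obtains l where "l \<in> standard_simplex d" and "x = (\<Sum>j\<le>d. l j *\<^sub>R V j)"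
proof -
  obtain u where u: "\<And>y. y \<in> V ` {..d} \<Longrightarrow> 0 \<le> u y" "sum u (V ` {..d}) = 1"
      "(\<Sum>y\<in>V ` {..d}. u y *\<^sub>R y) = x"
    using assms(2) by (auto simp: convex_hull_finite)
  define l where "l j = (if j \<le> d then u (V j) else 0)" for j
  have "l \<in> standard_simplex d"
    using u assms(1) by (intro standard_simplexI) (auto simp: l_def sum.reindex)
  moreover have "x = (\<Sum>j\<le>d. l j *\<^sub>R V j)"
    using u(3) assms(1) by (simp add: l_def sum.reindex)
  ultimately show thesis
    by (rule that)
qed

lemma shift_coefficients:
  fixes V :: "nat \<Rightarrow> 'a::real_vector"
  assumes "(\<Sum>j\<le>d. V j) = 0"
  shows "(\<Sum>j\<le>d. (c j + t) *\<^sub>R V j) = (\<Sum>j\<le>d. c j *\<^sub>R V j)"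
  using assms by (simp add: scaleR_add_left sum.distrib flip: scaleR_sum_right)

text \<open>Subtracting from the difference of the coefficients its mean turns a linear relation
  into an affine one, which must be trivial. The mean is the shift \<open>t\<close>.\<close>

lemma equal_combinations_differ_by_shift:
  fixes V :: "nat \<Rightarrow> 'a::real_vector"
  assumes inj: "inj_on V {..d}" and indep: "\<not> affine_dependent (V ` {..d})"
    and centred: "(\<Sum>j\<le>d. V j) = 0"
    and eq: "(\<Sum>j\<le>d. a j *\<^sub>R V j) = (\<Sum>j\<le>d. b j *\<^sub>R V j)"
  obtains t where "\<And>j. j \<le> d \<Longrightarrow> a j = b j + t"
proof -
  define t where "t = (\<Sum>j\<le>d. a j - b j) / real (Suc d)"
  define r where "r j = a j - b j + - t" for j
  have sum_r: "(\<Sum>j\<le>d. r j) = 0"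
    unfolding r_def sum.distrib by (simp add: t_def)
  have "(\<Sum>j\<le>d. r j *\<^sub>R V j) = (\<Sum>j\<le>d. (a j - b j) *\<^sub>R V j)"
    unfolding r_def by (rule shift_coefficients[OF centred])
  also have "\<dots> = 0"
    using eq by (simp add: scaleR_diff_left sum_subtractf)
  finally have comb_r: "(\<Sum>j\<le>d. r j *\<^sub>R V j) = 0" .
  define U where "U y = r (the_inv_into {..d} V y)" for y
  have U: "U (V j) = r j" if "j \<le> d" for j
    using that inj by (simp add: U_def the_inv_into_f_f)
  have "sum U (V ` {..d}) = 0" "(\<Sum>y\<in>V ` {..d}. U y *\<^sub>R y) = 0"
    using sum_r comb_r by (simp_all add: sum.reindex[OF inj] U)
  then have "\<forall>y\<in>V ` {..d}. U y = 0"
    using indep by (auto simp: affine_dependent_explicit_finite)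
  then have "r j = 0" if "j \<le> d" for j
    using U that by auto
  then show thesis
    using that[of t] by (force simp: r_def)
qed

section \<open>Weight functions and their inverses\<close>

lemma allowable_weightD:
  assumes "allowable_weight d w"
  shows "x \<in> {0..1} \<Longrightarrow> w x \<in> {0..1}" "strict_mono_on {0..1} w" "w 0 = 0" "w 1 = 1"
    "\<theta> \<in> standard_simplex d \<Longrightarrow> (\<Sum>i\<le>d. w (\<theta> i)) \<le> 1"
  using assms by (auto simp: allowable_weight_def)

text \<open>Continuing \<open>f\<close> by lines of slope \<open>1\<close> gives a monotone function onto the real line; its
  range is open, as the continuity criterion for monotone functions requires.\<close>

lemma mono_onto_interval_continuous:
  fixes f :: "real \<Rightarrow> real"
  assumes "a \<le> b" and mono: "mono_on {a..b} f" and onto: "f ` {a..b} = {f a..f b}"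
  shows "continuous_on {a..b} f"
proof -
  define g where "g x = (if x < a then f a + (x - a) else if x > b then f b + (x - b) else f x)" for x
  have "y \<in> range g" for y
  proof -
    consider "y < f a" | "y > f b" | "y \<in> {f a..f b}" by fastforce
    then show ?thesis
    proof cases
      case 1
      then have "g (a + (y - f a)) = y" by (simp add: g_def)
      then show ?thesis by (metis rangeI)
    next
      case 2
      then have "g (b + (y - f b)) = y" using \<open>a \<le> b\<close> by (simp add: g_def)
      then show ?thesis by (metis rangeI)
    next
      case 3
      then obtain x where "x \<in> {a..b}" "y = f x" using onto by blast
      then have "g x = y" by (simp add: g_def)
      then show ?thesis by (metis rangeI)
    qed
  qed
  then have "range g = UNIV" by blast
  moreover have "g x \<le> g y" if "x \<le> y" for x y
  proof -
    have f_le: "f s \<le> f t" if "a \<le> s" "s \<le> t" "t \<le> b" for s t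
      using that by (intro mono_onD[OF mono]) auto
    show ?thesis
      using that \<open>a \<le> b\<close> f_le[of a b] f_le[of a y] f_le[of x b] f_le[of x y]
      by (auto simp: g_def)
  qed
  ultimately have "continuous_on UNIV g"
    by (intro continuous_onI_mono) auto
  then have "continuous_on {a..b} g"
    by (rule continuous_on_subset) simp
  then show ?thesis
    by (rule continuous_on_eq) (simp add: g_def)
qed

lemma inv_into_strict_mono_on:
  fixes f :: "'a::linorder \<Rightarrow> 'b::linorder"
  assumes "strict_mono_on A f"
  shows "strict_mono_on (f ` A) (inv_into A f)"
proof (rule strict_mono_onI)
  fix x y assume xy: "x \<in> f ` A" "y \<in> f ` A" "x < y"
  show "inv_into A f x < inv_into A f y"
  proof (rule ccontr)
    assume "\<not> ?thesis"
    then have "inv_into A f y \<le> inv_into A f x" by simp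
    then have "f (inv_into A f y) \<le> f (inv_into A f x)"
      using xy by (intro strict_mono_on_leD[OF assms] inv_into_into)
    with xy show False by (simp add: f_inv_into_f)
  qed
qed

lemma inverse_weight:
  fixes w :: "real \<Rightarrow> real"
  assumes w: "allowable_weight d w" and bij: "bij_betw w {0..1} {0..1}"
  defines "v \<equiv> inv_into {0..1} w"
  shows "x \<in> {0..1} \<Longrightarrow> v x \<in> {0..1}" "x \<in> {0..1} \<Longrightarrow> w (v x) = x"
    "x \<in> {0..1} \<Longrightarrow> v (w x) = x" "v 0 = 0" "v 1 = 1"
    "\<lbrakk>0 \<le> x; x \<le> y; y \<le> 1\<rbrakk> \<Longrightarrow> v x \<le> v y" "continuous_on {0..1} v"
proof -
  have img: "w ` {0..1} = {0..1}" and inj: "inj_on w {0..1}"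
    using bij by (auto simp: bij_betw_def)
  show left: "v (w x) = x" if "x \<in> {0..1}" for x
    using that inj by (simp add: v_def)
  show "x \<in> {0..1} \<Longrightarrow> v x \<in> {0..1}"
    unfolding v_def using img inv_into_into[of x w "{0..1}"] by simp
  show "x \<in> {0..1} \<Longrightarrow> w (v x) = x"
    unfolding v_def using img f_inv_into_f[of x w "{0..1}"] by simp
  show v0: "v 0 = 0" and v1: "v 1 = 1"
    using left[of 0] left[of 1] allowable_weightD(3,4)[OF w] by simp_all
  have "strict_mono_on {0..1} v"
    using inv_into_strict_mono_on[OF allowable_weightD(2)[OF w]] img by (simp add: v_def)
  then have mono: "mono_on {0..1} v"
    by (rule strict_mono_on_imp_mono_on)
  then show "\<lbrakk>0 \<le> x; x \<le> y; y \<le> 1\<rbrakk> \<Longrightarrow> v x \<le> v y"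
    by (auto elim!: mono_onD)
  have "v ` {0..1} = {0..1}"
    using bij_betw_imp_surj_on[OF bij_betw_inv_into[OF bij]] by (simp add: v_def)
  with mono show "continuous_on {0..1} v"
    by (intro mono_onto_interval_continuous) (simp_all add: v0 v1)
qed

section \<open>The baryweight map and its image\<close>

lemma baryweight_map_inj:
  fixes V :: "nat \<Rightarrow> 'a::real_vector"
  assumes "inj_on V {..d}" and "\<not> affine_dependent (V ` {..d})" and "(\<Sum>j\<le>d. V j) = 0"
    and w: "strict_mono_on {0..1} w"
  shows "inj_on (baryweight_map d V w) (standard_simplex d)"
proof (rule inj_onI)
  fix \<theta> \<phi>
  assume \<theta>: "\<theta> \<in> standard_simplex d" and \<phi>: "\<phi> \<in> standard_simplex d"
    and "baryweight_map d V w \<theta> = baryweight_map d V w \<phi>"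
  then obtain t where t: "\<And>j. j \<le> d \<Longrightarrow> w (\<theta> j) = w (\<phi> j) + t"
    using equal_combinations_differ_by_shift[OF assms(1-3), of "\<lambda>j. w (\<theta> j)" "\<lambda>j. w (\<phi> j)"]
    unfolding baryweight_map_def by metis
  have no_domination: False
    if \<alpha>: "\<alpha> \<in> standard_simplex d" and \<beta>: "\<beta> \<in> standard_simplex d"
      and less: "\<And>j. j \<le> d \<Longrightarrow> w (\<alpha> j) < w (\<beta> j)"
    for \<alpha> \<beta>
  proof -
    have "\<alpha> j < \<beta> j" if "j \<le> d" for j
    proof (rule ccontr)
      assume "\<not> \<alpha> j < \<beta> j"
      then have "w (\<beta> j) \<le> w (\<alpha> j)"
        using \<alpha> \<beta> by (intro strict_mono_on_leD[OF w]) (auto simp: standard_simplexD)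
      with less[OF that] show False by simp
    qed
    then have "(\<Sum>j\<le>d. \<alpha> j) < (\<Sum>j\<le>d. \<beta> j)"
      by (intro sum_strict_mono) auto
    with \<alpha> \<beta> show False by (simp add: standard_simplexD)
  qed
  have "t = 0"
    using no_domination[OF \<theta> \<phi>] no_domination[OF \<phi> \<theta>] t by (cases t "0::real" rule: linorder_cases) auto
  then have "\<theta> j = \<phi> j" if "j \<le> d" for j
    using t[OF that] strict_mono_on_eq[OF w, of "\<theta> j" "\<phi> j"] \<theta> \<phi>
    by (simp add: standard_simplexD)
  then show "\<theta> = \<phi>"
    using standard_simplexD(3)[OF \<theta>] standard_simplexD(3)[OF \<phi>] by (metis ext not_le)
qed

text \<open>The defect \<open>1 - (\<Sum>j\<le>d. w (\<theta> j))\<close> is shared equally among the coordinates.\<close>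

lemma barycentric_coordinates_of_baryweights:
  fixes V :: "nat \<Rightarrow> 'a::real_vector"
  assumes centred: "(\<Sum>j\<le>d. V j) = 0" and w: "allowable_weight d w"
    and \<theta>: "\<theta> \<in> standard_simplex d"
  obtains l t where "l \<in> standard_simplex d" and "\<And>j. j \<le> d \<Longrightarrow> l j = w (\<theta> j) + t"
    and "baryweight_map d V w \<theta> = (\<Sum>j\<le>d. l j *\<^sub>R V j)"
proof -
  define t where "t = (1 - (\<Sum>j\<le>d. w (\<theta> j))) / real (Suc d)"
  define l where "l j = (if j \<le> d then w (\<theta> j) + t else 0)" for j
  have t: "0 \<le> t"
    using allowable_weightD(5)[OF w \<theta>] by (simp add: t_def)
  have "0 \<le> w (\<theta> j)" for j
    using allowable_weightD(1)[OF w, of "\<theta> j"] standard_simplexD(1,2)[OF \<theta>, of j] by simp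
  moreover have "(\<Sum>j\<le>d. l j) = 1"
    by (simp add: l_def sum.distrib t_def)
  ultimately have "l \<in> standard_simplex d"
    using t by (intro standard_simplexI) (auto simp: l_def)
  moreover have "(\<Sum>j\<le>d. l j *\<^sub>R V j) = (\<Sum>j\<le>d. (w (\<theta> j) + t) *\<^sub>R V j)"
    by (simp add: l_def)
  then have "baryweight_map d V w \<theta> = (\<Sum>j\<le>d. l j *\<^sub>R V j)"
    using shift_coefficients[OF centred, of "\<lambda>j. w (\<theta> j)" t] by (simp add: baryweight_map_def)
  ultimately show thesis
    using that[of l t] by (simp add: l_def)
qed

lemma baryweight_image_subset_region:
  fixes V :: "nat \<Rightarrow> 'a::real_vector"
  assumes centred: "(\<Sum>j\<le>d. V j) = 0" and w: "allowable_weight d w"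
    and bij: "bij_betw w {0..1} {0..1}"
  shows "baryweight_map d V w ` standard_simplex d \<subseteq> baryweight_region d V w"
proof (rule image_subsetI)
  fix \<theta> assume \<theta>: "\<theta> \<in> standard_simplex d"
  let ?v = "inv_into {0..1} w"
  obtain l t where l: "l \<in> standard_simplex d" "\<And>j. j \<le> d \<Longrightarrow> l j = w (\<theta> j) + t"
    "baryweight_map d V w \<theta> = (\<Sum>j\<le>d. l j *\<^sub>R V j)"
    using barycentric_coordinates_of_baryweights[OF centred w \<theta>] by metis
  define \<mu> where "\<mu> = Min (l ` {..d})"
  have \<theta>01: "\<theta> j \<in> {0..1}" for j
    using standard_simplexD[OF \<theta>] by simp
  have "t \<le> \<mu>"
    using l(2) allowable_weightD(1)[OF w \<theta>01] unfolding \<mu>_def by (subst Min_ge_iff) auto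
  have "?v (l j - \<mu>) \<le> \<theta> j" if "j \<le> d" for j
  proof -
    have "\<mu> \<le> l j"
      using that by (simp add: \<mu>_def)
    then have "?v (l j - \<mu>) \<le> ?v (w (\<theta> j))"
      using \<open>t \<le> \<mu>\<close> l(2)[OF that] allowable_weightD(1)[OF w \<theta>01, of j]
      by (intro inverse_weight(6)[OF w bij]) simp_all
    then show ?thesis
      by (simp only: inverse_weight(3)[OF w bij \<theta>01])
  qed
  then have "(\<Sum>j\<le>d. ?v (l j - \<mu>)) \<le> (\<Sum>j\<le>d. \<theta> j)"
    by (intro sum_mono) simp
  then have "(\<Sum>j\<le>d. ?v (l j - Min (l ` {..d}))) \<le> 1"
    using standard_simplexD(4)[OF \<theta>] by (simp only: \<mu>_def)
  with l(1,3) show "baryweight_map d V w \<theta> \<in> baryweight_region d V w"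
    unfolding baryweight_region_def by blast
qed

text \<open>The values of \<open>v\<close> at the coefficients shifted by \<open>t\<close> have a sum that is continuous in \<open>t\<close>
  and reaches \<open>1\<close> at the latest when the largest coefficient becomes \<open>1\<close>.\<close>

lemma baryweight_region_subset_image:
  fixes V :: "nat \<Rightarrow> 'a::real_vector"
  assumes centred: "(\<Sum>j\<le>d. V j) = 0" and w: "allowable_weight d w"
    and bij: "bij_betw w {0..1} {0..1}"
  shows "baryweight_region d V w \<subseteq> baryweight_map d V w ` standard_simplex d"
proof
  fix x assume "x \<in> baryweight_region d V w"
  let ?v = "inv_into {0..1} w"
  note v = inverse_weight[OF w bij]
  obtain l where l: "l \<in> standard_simplex d" and x: "x = (\<Sum>j\<le>d. l j *\<^sub>R V j)"
    and region: "(\<Sum>j\<le>d. ?v (l j - Min (l ` {..d}))) \<le> 1"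
    using \<open>x \<in> _\<close> by (auto simp: baryweight_region_def)
  define c where "c j = l j - Min (l ` {..d})" for j
  define M where "M = Max (c ` {..d})"
  have Min_nonneg: "0 \<le> Min (l ` {..d})"
    using standard_simplexD(1)[OF l] by (subst Min_ge_iff) auto
  have c: "0 \<le> c j" "c j \<le> 1" if "j \<le> d" for j
  proof -
    have "Min (l ` {..d}) \<le> l j"
      using that by simp
    then show "0 \<le> c j" "c j \<le> 1"
      using Min_nonneg standard_simplexD(2)[OF l, of j] unfolding c_def by linarith+
  qed
  have cM: "c j \<le> M" if "j \<le> d" for j
    using that by (simp add: M_def)
  obtain m where m: "m \<le> d" "c m = M"
    using Max_in[of "c ` {..d}"] by (fastforce simp: M_def)
  have M1: "M \<le> 1"
    using c(2)[OF m(1)] m by simp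
  have in01: "c j + t \<in> {0..1}" if "j \<le> d" "t \<in> {0..1 - M}" for j t
    using c(1)[of j] cM[of j] that by simp
  define g where "g t = (\<Sum>j\<le>d. ?v (c j + t))" for t
  have "continuous_on {0..1 - M} g"
    unfolding g_def using c(1) cM
    by (intro continuous_on_sum continuous_on_compose2[OF v(7)] continuous_intros) auto
  moreover have "g 0 \<le> 1"
    using region by (simp add: g_def c_def)
  moreover have "1 \<le> g (1 - M)"
  proof -
    have "?v (c m + (1 - M)) \<le> g (1 - M)"
      unfolding g_def using m v(1)[OF in01[of _ "1 - M"]] M1
      by (intro member_le_sum) auto
    then show ?thesis using m v(5) by simp
  qed
  ultimately obtain t where t: "t \<in> {0..1 - M}" "g t = 1"
    using IVT'[of g 0 1 "1 - M"] M1 by auto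
  define \<theta> where "\<theta> j = (if j \<le> d then ?v (c j + t) else 0)" for j
  have "\<theta> \<in> standard_simplex d"
    using t v(1)[OF in01] by (intro standard_simplexI) (auto simp: \<theta>_def g_def)
  moreover have "w (\<theta> j) = l j + (t - Min (l ` {..d}))" if "j \<le> d" for j
    using that v(2)[OF in01[OF that t(1)]] by (simp add: \<theta>_def c_def)
  then have "baryweight_map d V w \<theta> = (\<Sum>j\<le>d. (l j + (t - Min (l ` {..d}))) *\<^sub>R V j)"
    by (simp add: baryweight_map_def)
  then have "baryweight_map d V w \<theta> = x"
    using shift_coefficients[OF centred] x by metis
  ultimately show "x \<in> baryweight_map d V w ` standard_simplex d"
    by blast
qed

lemma baryweight_region_subset_hull:
  fixes V :: "nat \<Rightarrow> 'a::real_vector"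
  shows "baryweight_region d V w \<subseteq> convex hull (V ` {..d})"
  by (auto simp: baryweight_region_def intro: simplex_combination_in_hull)

text \<open>The inverse of a complementary function is complementary, so \<open>b \<le> 1 - a\<close> gives
  \<open>v a + v b \<le> 1\<close>.\<close>

lemma complementary_inverse_sum_le_1:
  assumes w: "allowable_weight d w" and bij: "bij_betw w {0..1} {0..1}" and "complementary w"
    and ab: "0 \<le> a" "0 \<le> b" "a + b \<le> 1"
  shows "inv_into {0..1} w a + inv_into {0..1} w b \<le> 1"
proof -
  let ?v = "inv_into {0..1} w"
  note v = inverse_weight[OF w bij]
  have va: "?v a \<in> {0..1}" "w (?v a) = a"
    using v(1,2)[of a] ab by simp_all
  then have "w (1 - ?v a) = 1 - a"
    using \<open>complementary w\<close> by (force simp: complementary_def)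
  then have "?v (1 - a) = 1 - ?v a"
    using v(3)[of "1 - ?v a"] va(1) by simp
  moreover have "?v b \<le> ?v (1 - a)"
    using ab by (intro v(6)) auto
  ultimately show ?thesis by simp
qed

lemma triangle_region_eq_hull:
  fixes V :: "nat \<Rightarrow> 'a::real_vector"
  assumes "inj_on V {..2}" and w: "allowable_weight d w"
    and bij: "bij_betw w {0..1} {0..1}" and compl: "complementary w"
  shows "baryweight_region 2 V w = convex hull (V ` {..2})"
proof
  show "convex hull (V ` {..2}) \<subseteq> baryweight_region 2 V w"
  proof
    fix x assume "x \<in> convex hull (V ` {..2})"
    then obtain l where l: "l \<in> standard_simplex 2" and x: "x = (\<Sum>j\<le>2. l j *\<^sub>R V j)"
      using hull_point_is_simplex_combination[OF assms(1)] by metis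
    let ?v = "inv_into {0..1} w" and ?m = "Min (l ` {..2})"
    have atMost_2: "{..2::nat} = {0, 1, 2}" by auto
    have sum_l: "l 0 + l 1 + l 2 = 1"
      using standard_simplexD(4)[OF l] by (simp add: atMost_2 add.assoc)
    have nonneg: "0 \<le> l j" for j
      by (rule standard_simplexD(1)[OF l])
    have m_le: "?m \<le> l 0" "?m \<le> l 1" "?m \<le> l 2"
      by simp_all
    have "?m \<in> l ` {..2}"
      by (intro Min_in) auto
    then have "?m = l 0 \<or> ?m = l 1 \<or> ?m = l 2"
      by (auto simp: atMost_2)
    (* the vertex with the least coordinate contributes ?v 0 = 0, which leaves two summands *)
    then have "?v (l 0 - ?m) + ?v (l 1 - ?m) + ?v (l 2 - ?m) \<le> 1"
      using complementary_inverse_sum_le_1[OF w bij compl, of "l 0 - ?m" "l 1 - ?m"]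
        complementary_inverse_sum_le_1[OF w bij compl, of "l 0 - ?m" "l 2 - ?m"]
        complementary_inverse_sum_le_1[OF w bij compl, of "l 1 - ?m" "l 2 - ?m"]
        inverse_weight(4)[OF w bij] m_le sum_l nonneg[of 0] nonneg[of 1] nonneg[of 2]
      by (elim disjE) simp_all
    then have "(\<Sum>j\<le>2. ?v (l j - ?m)) \<le> 1"
      by (simp add: atMost_2 add.assoc)
    with l x show "x \<in> baryweight_region 2 V w"
      by (auto simp: baryweight_region_def)
  qed
qed (rule baryweight_region_subset_hull)

lemma unique_baryweights_of_image_point:
  assumes inj: "inj_on (baryweight_map d V w) (standard_simplex d)"
    and x: "x \<in> baryweight_map d V w ` standard_simplex d"
  shows "\<exists>!b. is_baryweights d V w x b"
proof -
  obtain \<theta> where \<theta>: "\<theta> \<in> standard_simplex d" "x = baryweight_map d V w \<theta>"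
    using x by blast
  have "b = (\<lambda>j. w (\<theta> j))" if b: "is_baryweights d V w x b" for b
  proof -
    obtain \<phi> where "\<phi> \<in> standard_simplex d" "b = (\<lambda>j. w (\<phi> j))" "x = baryweight_map d V w \<phi>"
      using b by (auto simp: is_baryweights_def baryweight_map_def)
    with \<theta> inj show ?thesis by (metis inj_onD)
  qed
  moreover have "is_baryweights d V w x (\<lambda>j. w (\<theta> j))"
    using \<theta> by (auto simp: is_baryweights_def baryweight_map_def)
  ultimately show ?thesis by blast
qed

theorem proposition5:
  fixes d :: nat and V :: "nat \<Rightarrow> real ^ 'n" and w :: "real \<Rightarrow> real"
  assumes "d \<ge> 1" and "CARD('n) = d"
    and "inj_on V {..d}" and "\<not> affine_dependent (V ` {..d})"
    and "(\<Sum>j\<le>d. V j) = 0"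
    and "allowable_weight d w"
  shows "inj_on (baryweight_map d V w) (standard_simplex d) \<and>
    baryweight_map d V w ` standard_simplex d \<subseteq> convex hull (V ` {..d}) \<and>
    baryweight_region d V w \<subseteq> convex hull (V ` {..d}) \<and>
    (bij_betw w {0..1} {0..1} \<longrightarrow>
       baryweight_map d V w ` standard_simplex d = baryweight_region d V w \<and>
       (complementary w \<and> d = 2 \<longrightarrow>
          baryweight_region d V w = convex hull (V ` {..d}) \<and>
          (\<forall>x\<in>convex hull (V ` {..d}). \<exists>!b. is_baryweights d V w x b)))"
proof -
  have inj: "inj_on (baryweight_map d V w) (standard_simplex d)"
    by (rule baryweight_map_inj[OF assms(3-5) allowable_weightD(2)[OF assms(6)]])
  have "baryweight_map d V w \<theta> \<in> convex hull (V ` {..d})" if "\<theta> \<in> standard_simplex d" for \<theta>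
    using barycentric_coordinates_of_baryweights[OF assms(5,6) that] simplex_combination_in_hull
    by metis
  then have image_hull: "baryweight_map d V w ` standard_simplex d \<subseteq> convex hull (V ` {..d})"
    by blast
  have image_region: "baryweight_map d V w ` standard_simplex d = baryweight_region d V w"
    if "bij_betw w {0..1} {0..1}"
    using baryweight_image_subset_region[OF assms(5,6) that]
      baryweight_region_subset_image[OF assms(5,6) that] by (rule subset_antisym)
  have triangle: "baryweight_region d V w = convex hull (V ` {..d})"
    if "bij_betw w {0..1} {0..1}" "complementary w" "d = 2"
    using triangle_region_eq_hull[of V d w] assms(3,6) that by simp
  have unique: "\<forall>x\<in>convex hull (V ` {..d}). \<exists>!b. is_baryweights d V w x b"
    if "bij_betw w {0..1} {0..1}" "complementary w" "d = 2"
    using unique_baryweights_of_image_point[OF inj] image_region triangle that by blast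
  show ?thesis
    using inj image_hull baryweight_region_subset_hull[of d V w] image_region triangle unique
    by blast
qed

end
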